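(* Let $X$ be a complex Banach space with Schauder basis $\{e_n\}_{n\in\mathbb{N}}$ and let $g=\sum_{n=1}^\infty g_n e_n^*\in\mathcal{H}^\infty(B_X,X^* )$. Then $g=df$ for some $f\in\mathcal{H}L_0(B_X)$ if and only if $$\frac{\partial g_n}{\partial x_k}(x)=\frac{\partial g_k}{\partial x_n}(x)$$ for every $x\in B_X$ and every $k,n\in\mathbb{N}$.
   Context: $B_X$ is the open unit ball of $X$ and $X^*$ is the topological dual of $X$. For a complex Banach space $Y$, a map $f:B_X\to Y$ is holomorphic if it is (complex) Fréchet differentiable at every point of $B_X$; its differential at $x$ is the continuous complex-linear map $df(x):X\to Y$. $\mathcal{H}^\infty(B_X,Y)$ is the Banach space of bounded holomorphic maps $f:B_X\to Y$ with the sup norm. $\mathcal{H}L_0(B_X)$ is the space of all bounded holomorphic functions $f:B_X\to\mathbb{C}$ which are Lipschitz and satisfy $f(0)=0$. $\{e_n^*\}_n\subset X^*$ is the sequence such that $\{e_n,e_n^*\}_n$ is a biorthogonal system, i.e. $e_n^*(e_k)=\delta_{nk}$ (the coordinate functionals of the basis). Every $g\in\mathcal{H}^\infty(B_X,X^* )$ can be written as $g(x)=\sum_{n=1}^\infty g_n(x)e_n^*$ for $x\in B_X$, where the series converges in the weak-star topology $w(X^*,X)$ and $g_n:B_X\to\mathbb{C}$, $g_n(x)=g(x)(e_n)$, is a bounded holomorphic function; this is the meaning of $g=\sum_{n=1}^\infty g_ne_n^*$. The partial derivative is $\frac{\partial g_n}{\partial x_k}(x)=dg_n(x)(e_k)$.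 *)

theory Defs
  imports "HOL-Analysis.Analysis"
begin

section \<open>Complex Banach spaces\<close>

text \<open>A complex normed space is a real normed space (so that the topology, limits and Frechet
  derivatives of the library apply) with a compatible multiplication by complex scalars.\<close>

class complex_vector = real_vector +
  fixes scaleC :: "complex \<Rightarrow> 'a \<Rightarrow> 'a" (infixr "*\<^sub>C" 75)
  assumes scaleC_add_right: "c *\<^sub>C (x + y) = c *\<^sub>C x + c *\<^sub>C y"
    and scaleC_add_left: "(c + d) *\<^sub>C x = c *\<^sub>C x + d *\<^sub>C x"
    and scaleC_scaleC: "c *\<^sub>C d *\<^sub>C x = (c * d) *\<^sub>C x"
    and scaleC_one: "1 *\<^sub>C x = x"
    and scaleR_scaleC: "r *\<^sub>R x = complex_of_real r *\<^sub>C x"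

class complex_normed_vector = complex_vector + real_normed_vector +
  assumes norm_scaleC: "norm (c *\<^sub>C x) = cmod c * norm x"

class complex_banach = complex_normed_vector + complete_space

subclass (in complex_banach) banach ..

instantiation complex :: complex_banach
begin

definition scaleC_complex :: "complex \<Rightarrow> complex \<Rightarrow> complex" where
  "scaleC_complex c z = c * z"

instance
  by standard (auto simp: scaleC_complex_def algebra_simps norm_mult scaleR_conv_of_real)

end

section \<open>The topological dual\<close>

text \<open>The library's bounded operators are real-linear; the dual consists of the complex-linear
  ones among those with values in the complex numbers, with the operator norm.\<close>

typedef (overloaded) 'a cdual =
  "{\<phi> :: 'a::complex_normed_vector \<Rightarrow>\<^sub>L complex. \<forall>c x. \<phi> (c *\<^sub>C x) = c * \<phi> x}"
  morphisms blinfun_of_cdual cdual_of_blinfun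
  by (rule exI[of _ 0]) auto

abbreviation cdual_apply :: "'a::complex_normed_vector cdual \<Rightarrow> 'a \<Rightarrow> complex" where
  "cdual_apply \<phi> \<equiv> blinfun_apply (blinfun_of_cdual \<phi>)"

lemma cdual_apply_scaleC: "cdual_apply \<phi> (c *\<^sub>C x) = c * cdual_apply \<phi> x"
  using blinfun_of_cdual[of \<phi>] by blast

lemma cdual_eqI: "(\<And>x. cdual_apply \<phi> x = cdual_apply \<psi> x) \<Longrightarrow> \<phi> = \<psi>"
  by (meson blinfun_eqI blinfun_of_cdual_inject)

instantiation cdual :: (complex_normed_vector) complex_normed_vector
begin

definition "0 = cdual_of_blinfun 0"
definition "\<phi> + \<psi> = cdual_of_blinfun (blinfun_of_cdual \<phi> + blinfun_of_cdual \<psi>)"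
definition "\<phi> - \<psi> = cdual_of_blinfun (blinfun_of_cdual \<phi> - blinfun_of_cdual \<psi>)"
definition "- \<phi> = cdual_of_blinfun (- blinfun_of_cdual \<phi>)"
definition "r *\<^sub>R \<phi> = cdual_of_blinfun (r *\<^sub>R blinfun_of_cdual \<phi>)"
definition "c *\<^sub>C \<phi> = cdual_of_blinfun (Blinfun (\<lambda>x. c * cdual_apply \<phi> x))"
definition "norm \<phi> = norm (blinfun_of_cdual \<phi>)"
definition "dist \<phi> \<psi> = norm (\<phi> - \<psi>)" for \<phi> \<psi> :: "'a cdual"
definition "sgn \<phi> = inverse (norm \<phi>) *\<^sub>R \<phi>" for \<phi> :: "'a cdual"
definition uniformity_cdual_def:
  "(uniformity :: ('a cdual \<times> 'a cdual) filter) = (INF e\<in>{0<..}. principal {(x, y). dist x y < e})"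
definition open_cdual_def:
  "open (U :: 'a cdual set) = (\<forall>x\<in>U. \<forall>\<^sub>F (x', y) in uniformity. x' = x \<longrightarrow> y \<in> U)"

lemma blinfun_of_cdual_zero: "blinfun_of_cdual (0 :: 'a cdual) = 0"
  unfolding zero_cdual_def by (rule cdual_of_blinfun_inverse) simp

lemma blinfun_of_cdual_plus:
  "blinfun_of_cdual (\<phi> + \<psi> :: 'a cdual) = blinfun_of_cdual \<phi> + blinfun_of_cdual \<psi>"
  unfolding plus_cdual_def
  by (rule cdual_of_blinfun_inverse)
    (simp add: cdual_apply_scaleC blinfun.add_left distrib_left)

lemma blinfun_of_cdual_minus:
  "blinfun_of_cdual (\<phi> - \<psi> :: 'a cdual) = blinfun_of_cdual \<phi> - blinfun_of_cdual \<psi>"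
  unfolding minus_cdual_def
  by (rule cdual_of_blinfun_inverse)
    (simp add: cdual_apply_scaleC blinfun.diff_left right_diff_distrib)

lemma blinfun_of_cdual_uminus:
  "blinfun_of_cdual (- \<phi> :: 'a cdual) = - blinfun_of_cdual \<phi>"
  unfolding uminus_cdual_def
  by (rule cdual_of_blinfun_inverse) (simp add: cdual_apply_scaleC blinfun.minus_left)

lemma blinfun_of_cdual_scaleR:
  "blinfun_of_cdual (r *\<^sub>R \<phi> :: 'a cdual) = r *\<^sub>R blinfun_of_cdual \<phi>"
  unfolding scaleR_cdual_def
  by (rule cdual_of_blinfun_inverse) (simp add: cdual_apply_scaleC blinfun.scaleR_left)

lemma cdual_apply_scaleC_left:
  "cdual_apply (c *\<^sub>C \<phi> :: 'a cdual) x = c * cdual_apply \<phi> x"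
proof -
  have "bounded_linear (\<lambda>x. c * cdual_apply \<phi> x)"
    by (intro bounded_linear_intros)
  then have *: "blinfun_apply (Blinfun (\<lambda>x. c * cdual_apply \<phi> x)) = (\<lambda>x. c * cdual_apply \<phi> x)"
    by (rule bounded_linear_Blinfun_apply)
  then show ?thesis
    unfolding scaleC_cdual_def
    by (subst cdual_of_blinfun_inverse) (auto simp: cdual_apply_scaleC mult.left_commute)
qed

lemmas cdual_simps = blinfun_of_cdual_zero blinfun_of_cdual_plus blinfun_of_cdual_minus
  blinfun_of_cdual_uminus blinfun_of_cdual_scaleR cdual_apply_scaleC_left

instance
proof
  fix \<phi> \<psi> \<theta> :: "'a cdual" and c d :: complex and r s :: real
  show "\<phi> + \<psi> + \<theta> = \<phi> + (\<psi> + \<theta>)" "\<phi> + \<psi> = \<psi> + \<phi>" "0 + \<phi> = \<phi>"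
    "- \<phi> + \<phi> = 0" "\<phi> - \<psi> = \<phi> + - \<psi>"
    "r *\<^sub>R (\<phi> + \<psi>) = r *\<^sub>R \<phi> + r *\<^sub>R \<psi>" "(r + s) *\<^sub>R \<phi> = r *\<^sub>R \<phi> + s *\<^sub>R \<phi>"
    "r *\<^sub>R s *\<^sub>R \<phi> = (r * s) *\<^sub>R \<phi>" "1 *\<^sub>R \<phi> = \<phi>"
    by (simp_all add: blinfun_of_cdual_inject[symmetric] cdual_simps algebra_simps)
  show "c *\<^sub>C (\<phi> + \<psi>) = c *\<^sub>C \<phi> + c *\<^sub>C \<psi>" "(c + d) *\<^sub>C \<phi> = c *\<^sub>C \<phi> + d *\<^sub>C \<phi>"
    "c *\<^sub>C d *\<^sub>C \<phi> = (c * d) *\<^sub>C \<phi>" "1 *\<^sub>C \<phi> = \<phi>" "r *\<^sub>R \<phi> = complex_of_real r *\<^sub>C \<phi>"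
    by (rule cdual_eqI, simp add: cdual_simps blinfun.add_left blinfun.scaleR_left
        algebra_simps scaleR_conv_of_real)+
  show "dist \<phi> \<psi> = norm (\<phi> - \<psi>)" "sgn \<phi> = inverse (norm \<phi>) *\<^sub>R \<phi>"
    by (simp_all add: dist_cdual_def sgn_cdual_def)
  show "(uniformity :: ('a cdual \<times> 'a cdual) filter)
      = (INF e\<in>{0<..}. principal {(x, y). dist x y < e})"
    by (rule uniformity_cdual_def)
  show "open U = (\<forall>x\<in>U. \<forall>\<^sub>F (x', y) in uniformity. x' = x \<longrightarrow> y \<in> U)" for U :: "'a cdual set"
    by (rule open_cdual_def)
  show "norm \<phi> = 0 \<longleftrightarrow> \<phi> = 0"
    by (simp add: norm_cdual_def blinfun_of_cdual_inject[symmetric] cdual_simps)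
  show "norm (\<phi> + \<psi>) \<le> norm \<phi> + norm \<psi>"
    by (simp add: norm_cdual_def cdual_simps norm_triangle_ineq)
  show "norm (r *\<^sub>R \<phi>) = \<bar>r\<bar> * norm \<phi>"
    by (simp add: norm_cdual_def cdual_simps)
  have le: "norm (c *\<^sub>C \<phi>) \<le> cmod c * norm \<phi>" for c and \<phi> :: "'a cdual"
    unfolding norm_cdual_def
  proof (rule norm_blinfun_bound)
    show "norm (cdual_apply (c *\<^sub>C \<phi>) x)
        \<le> cmod c * norm (blinfun_of_cdual \<phi>) * norm x" for x
      using mult_left_mono[OF norm_blinfun[of "blinfun_of_cdual \<phi>" x], of "cmod c"]
      by (simp add: cdual_simps norm_mult mult.assoc)
  qed simp
  show "norm (c *\<^sub>C \<phi>) = cmod c * norm \<phi>"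
  proof (cases "c = 0")
    case True
    with le[of c \<phi>] show ?thesis by (simp add: norm_cdual_def)
  next
    case False
    have "inverse c *\<^sub>C c *\<^sub>C \<phi> = \<phi>"
      using False by (intro cdual_eqI) (simp add: cdual_simps)
    with le[of "inverse c" "c *\<^sub>C \<phi>"] have "norm \<phi> \<le> norm (c *\<^sub>C \<phi>) / cmod c"
      by (simp add: norm_inverse divide_inverse mult.commute)
    with False have "cmod c * norm \<phi> \<le> norm (c *\<^sub>C \<phi>)"
      by (simp add: field_simps)
    with le[of c \<phi>] show ?thesis by simp
  qed
qed

end

instance cdual :: (complex_normed_vector) complex_banach
proof
  fix S :: "nat \<Rightarrow> 'a cdual"
  assume "Cauchy S"
  then have "Cauchy (\<lambda>n. blinfun_of_cdual (S n))"
    by (simp add: Cauchy_def dist_norm norm_cdual_def cdual_simps)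
  then obtain \<Phi> where \<Phi>: "(\<lambda>n. blinfun_of_cdual (S n)) \<longlonglongrightarrow> \<Phi>"
    using Cauchy_convergent convergent_def by blast
  have lim: "(\<lambda>n. cdual_apply (S n) x) \<longlonglongrightarrow> \<Phi> x" for x
    by (intro tendsto_intros \<Phi>)
  have "\<Phi> (c *\<^sub>C x) = c * \<Phi> x" for c x
    using LIMSEQ_unique[OF lim[of "c *\<^sub>C x"]] tendsto_mult_left[OF lim[of x], of c]
    by (simp add: cdual_apply_scaleC)
  then have "blinfun_of_cdual (cdual_of_blinfun \<Phi>) = \<Phi>"
    by (intro cdual_of_blinfun_inverse) simp
  with \<Phi> have "S \<longlonglongrightarrow> cdual_of_blinfun \<Phi>"
    by (simp add: tendsto_iff dist_norm norm_cdual_def cdual_simps)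
  then show "convergent S"
    by (rule convergentI)
qed

section \<open>Holomorphic maps on the open unit ball\<close>

text \<open>Maps on the unit ball are total functions of which only the values on \<^term>\<open>ball 0 1\<close>
  matter. Complex Frechet differentiability is real Frechet differentiability with a
  complex-linear derivative.\<close>

definition holomorphic_on_unit_ball ::
    "('a::complex_normed_vector \<Rightarrow> 'b::complex_normed_vector) \<Rightarrow> bool" where
  "holomorphic_on_unit_ball f \<longleftrightarrow>
    (\<forall>x\<in>ball 0 1. \<exists>D. (f has_derivative D) (at x) \<and> (\<forall>c v. D (c *\<^sub>C v) = c *\<^sub>C D v))"

definition H_infinity :: "('a::complex_banach \<Rightarrow> 'b::complex_banach) set" where
  "H_infinity = {f. holomorphic_on_unit_ball f \<and> bounded (f ` ball 0 1)}"

definition HL0 :: "('a::complex_banach \<Rightarrow> complex) set" where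
  "HL0 = {f \<in> H_infinity. (\<exists>L. L-lipschitz_on (ball 0 1) f) \<and> f 0 = 0}"

definition differential ::
    "('a::complex_banach \<Rightarrow> 'b::complex_banach) \<Rightarrow> 'a \<Rightarrow> 'a \<Rightarrow> 'b" where
  "differential f x = frechet_derivative f (at x)"

lemma differential_eqI: "(f has_derivative D) (at x) \<Longrightarrow> differential f x = D"
  unfolding differential_def by (rule frechet_derivative_at[symmetric])

definition partial_derivative ::
    "(nat \<Rightarrow> 'a::complex_banach) \<Rightarrow> nat \<Rightarrow> ('a \<Rightarrow> complex) \<Rightarrow> 'a \<Rightarrow> complex" where
  "partial_derivative e k h x = differential h x (e k)"

section \<open>Schauder bases\<close>

definition schauder_basis :: "(nat \<Rightarrow> 'a::complex_banach) \<Rightarrow> bool" where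
  "schauder_basis e \<longleftrightarrow> (\<forall>x. \<exists>!a. (\<lambda>n. a n *\<^sub>C e n) sums x)"

text \<open>The coordinate functional \<open>e\<^sub>n\<^sup>*\<close>, as a function. (Its continuity is a theorem of Banach,
  which is not needed to state pointwise, i.e. weak-star, convergence.)\<close>

definition coord :: "(nat \<Rightarrow> 'a::complex_banach) \<Rightarrow> nat \<Rightarrow> 'a \<Rightarrow> complex" where
  "coord e n x = (THE a. (\<lambda>n. a n *\<^sub>C e n) sums x) n"

text \<open>\<open>g = (\<Sum>n. g\<^sub>n e\<^sub>n\<^sup>*)\<close> on the unit ball, with convergence in \<open>w(X\<^sup>*, X)\<close>.\<close>

definition coord_expansion ::
    "(nat \<Rightarrow> 'a::complex_banach) \<Rightarrow> (nat \<Rightarrow> 'a \<Rightarrow> complex) \<Rightarrow> ('a \<Rightarrow> 'a cdual) \<Rightarrow> bool" where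
  "coord_expansion e gn g \<longleftrightarrow>
    (\<forall>x\<in>ball 0 1. \<forall>y. (\<lambda>n. gn n x * coord e n y) sums cdual_apply (g x) y)"

lemma coord_sums:
  assumes "schauder_basis e"
  shows "(\<lambda>n. coord e n x *\<^sub>C e n) sums x"
  using theI'[of "\<lambda>a. (\<lambda>n. a n *\<^sub>C e n) sums x"] assms
  unfolding schauder_basis_def coord_def by blast

lemma coord_unique:
  assumes "schauder_basis e" "(\<lambda>n. a n *\<^sub>C e n) sums x"
  shows "coord e n x = a n"
proof -
  have "(\<lambda>n. coord e n x) = a"
    using assms coord_sums[OF assms(1), of x] unfolding schauder_basis_def by metis
  then show ?thesis by metis
qed

lemma scaleC_zero_left: "0 *\<^sub>C x = (0 :: 'a::complex_vector)"
  using scaleR_scaleC[of 0 x] by simp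

lemma coord_basis:
  assumes "schauder_basis e"
  shows "coord e n (e k) = (if n = k then 1 else 0)"
proof (rule coord_unique[OF assms])
  have "(\<lambda>n. (if n = k then 1 else 0) *\<^sub>C e n) = (\<lambda>n. if n = k then e n else 0)"
    by (auto simp: scaleC_one scaleC_zero_left)
  then show "(\<lambda>n. (if n = k then 1 else 0) *\<^sub>C e n) sums e k"
    using sums_single[of k e] by simp
qed

lemma coord_expansion_iff:
  assumes "schauder_basis e"
  shows "coord_expansion e gn g \<longleftrightarrow> (\<forall>x\<in>ball 0 1. \<forall>n. gn n x = cdual_apply (g x) (e n))"
proof (intro iffI ballI allI)
  fix x :: 'a and k
  assume "coord_expansion e gn g" "x \<in> ball 0 1"
  then have "(\<lambda>n. gn n x * coord e n (e k)) sums cdual_apply (g x) (e k)"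
    unfolding coord_expansion_def by blast
  moreover have "(\<lambda>n. gn n x * coord e n (e k)) = (\<lambda>n. if n = k then gn n x else 0)"
    by (auto simp: coord_basis[OF assms])
  ultimately have "(\<lambda>n. if n = k then gn n x else 0) sums cdual_apply (g x) (e k)"
    by simp
  with sums_single[of k "\<lambda>n. gn n x"] show "gn k x = cdual_apply (g x) (e k)"
    using sums_unique2 by blast
next
  assume *: "\<forall>x\<in>ball 0 1. \<forall>n. gn n x = cdual_apply (g x) (e n)"
  show "coord_expansion e gn g"
    unfolding coord_expansion_def
  proof (intro ballI allI)
    fix x y :: 'a
    assume x: "x \<in> ball 0 1"
    have "(\<lambda>n. cdual_apply (g x) (coord e n y *\<^sub>C e n)) sums cdual_apply (g x) y"
      by (rule bounded_linear.sums[OF blinfun.bounded_linear_right coord_sums[OF assms]])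
    then show "(\<lambda>n. gn n x * coord e n y) sums cdual_apply (g x) y"
      using * x by (simp add: cdual_apply_scaleC mult.commute)
  qed
qed

end

theory Submission
  imports Defs "HOL-Complex_Analysis.Cauchy_Integral_Formula"
begin

text \<open>
  Writing \<open>D x\<close> for the derivative of \<open>g\<close> at \<open>x\<close>, the function \<open>g\<^sub>n\<close> is \<open>g\<close> followed by evaluation at
  \<open>e\<^sub>n\<close>, so that \<open>\<partial>g\<^sub>n/\<partial>x\<^sub>k (x) = D x (e\<^sub>k) (e\<^sub>n)\<close>. The condition on the partial derivatives
  therefore says that the bilinear form \<open>(v, w) \<mapsto> D x v w\<close> is symmetric on basis vectors. Expanding
  \<open>v\<close> and \<open>w\<close> in the basis, one variable at a time, shows that it is then symmetric on the whole space
  (\<open>symmetric_if_symmetric_on_basis\<close>). The theorem is thus a Poincare lemma: \<open>g\<close> is exact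
  if and only if its derivative is symmetric at every point of the ball.

  If \<open>g = df\<close>, then \<open>D x\<close> is the second derivative of \<open>f\<close>, and it is symmetric
  because it is a limit of second differences of \<open>f\<close>, which are symmetric in the two
  increments (\<open>second_derivative_symmetric\<close>).

  Conversely, if \<open>D x\<close> is symmetric, a primitive is \<open>f x = \<integral>\<^sub>0\<^sup>1 g (t x) x dt\<close>
  (\<open>poincare_unit_ball\<close>). The delicate point is to differentiate under the integral sign without
  knowing that \<open>D\<close> is continuous. Holomorphy and boundedness replace continuity: for a small
  increment \<open>h\<close> and fixed \<open>t\<close>, the function \<open>\<phi>\<^sub>t z = g (t (x + z h)) (x + z h)\<close> is
  holomorphic and bounded by a bound for \<open>g\<close> on a disc whose radius is proportional to
  \<open>1 / \<parallel>h\<parallel>\<close>. By the Cauchy inequality for the second derivative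
  (\<open>bounded_holomorphic_linear_remainder\<close>) the difference \<open>\<phi>\<^sub>t 1 - \<phi>\<^sub>t 0 - \<phi>\<^sub>t' 0\<close> is \<open>O(\<parallel>h\<parallel>\<^sup>2)\<close>
  uniformly in \<open>t\<close>. Symmetry turns \<open>\<phi>\<^sub>t' 0 = t D (t x) h x + g (t x) h\<close> into the derivative of
  \<open>t \<mapsto> t g (t x) h\<close>, so its integral is \<open>g x h\<close>, and hence
  \<open>f (x + h) - f x - g x h = O(\<parallel>h\<parallel>\<^sup>2)\<close>.
  Finally, \<open>f\<close> is Lipschitz on the convex ball since its derivative \<open>g\<close> is bounded there.
\<close>

section \<open>Symmetry of the second derivative\<close>

text \<open>The second difference is the increment along \<open>w\<close> of \<open>y \<mapsto> f (y + v) - f y\<close>. The derivative of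
  this function is \<open>F (y + v) - F y\<close>, which differs from \<open>D v\<close> by the linearization errors
  of \<open>F\<close> at the two points \<open>y + v\<close> and \<open>y\<close>; the mean value inequality does the rest.\<close>

lemma second_difference_bound:
  fixes f :: "'a::real_normed_vector \<Rightarrow> 'b::real_normed_vector"
    and F :: "'a \<Rightarrow> 'a \<Rightarrow>\<^sub>L 'b"
  assumes f: "\<And>y. y \<in> ball x r \<Longrightarrow> (f has_derivative F y) (at y)"
    and lin: "bounded_linear D"
    and F: "\<And>y. y \<in> ball x r \<Longrightarrow> norm (F y - F x - D (y - x)) \<le> \<epsilon> * norm (y - x)"
    and small: "norm v + norm w < r" and eps: "0 \<le> \<epsilon>"
  shows "norm (f (x + v + w) - f (x + v) - f (x + w) + f x - D v w)
           \<le> 2 * \<epsilon> * (norm v + norm w)\<^sup>2"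
proof -
  define \<psi> where "\<psi> y = f (y + v) - f y - D v y" for y
  let ?G = "(\<lambda>s. x + s *\<^sub>R w) ` {0..1}"
  have inball: "y + v \<in> ball x r" "y \<in> ball x r"
    "norm (y + v - x) \<le> norm v + norm w" "norm (y - x) \<le> norm v + norm w"
    if y: "y \<in> ?G" for y
  proof -
    obtain s where s: "0 \<le> s" "s \<le> 1" "y = x + s *\<^sub>R w" using y by auto
    have "norm (s *\<^sub>R w) \<le> norm w" using s by (simp add: mult_left_le_one_le)
    moreover have "norm (s *\<^sub>R w + v) \<le> norm (s *\<^sub>R w) + norm v"
      by (rule norm_triangle_ineq)
    moreover have "y + v - x = s *\<^sub>R w + v" "y - x = s *\<^sub>R w" using s by auto
    ultimately show 1: "norm (y + v - x) \<le> norm v + norm w" "norm (y - x) \<le> norm v + norm w"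
      by (simp_all only:) (use norm_ge_zero[of v] in linarith)+
    then show "y + v \<in> ball x r" "y \<in> ball x r"
      using small by (simp_all add: dist_norm norm_minus_commute)
  qed
  have "norm (\<psi> (x + w) - \<psi> x) \<le> norm w * (2 * \<epsilon> * (norm v + norm w))"
  proof (rule differentiable_bound_segment[where G = ?G and f' = "\<lambda>y. F (y + v) - F y - D v"])
    show "(\<psi> has_derivative F (y + v) - F y - D v) (at y within ?G)" if y: "y \<in> ?G" for y
    proof -
      have shift: "((\<lambda>y. f (y + v)) has_derivative F (y + v)) (at y)"
        by (rule has_derivative_compose[where f = "\<lambda>y. y + v" and g = f])
          (auto intro!: derivative_eq_intros f inball(1)[OF y])
      show ?thesis
        unfolding \<psi>_def
        by (rule has_derivative_at_withinI)
          (auto intro!: derivative_eq_intros shift f inball(2)[OF y] simp: blinfun.bilinear_simps)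
    qed
    show "onorm (F (x + s *\<^sub>R w + v) - F (x + s *\<^sub>R w) - D v) \<le> 2 * \<epsilon> * (norm v + norm w)"
      if s: "s \<in> {0..1}" for s
    proof -
      let ?y = "x + s *\<^sub>R w"
      have y: "?y \<in> ?G" using s by auto
      have "D (?y + v - x) - D (?y - x) = D v"
        by (simp add: bounded_linear.linear[OF lin] linear_diff[symmetric])
      then have "F (?y + v) - F ?y - D v
          = (F (?y + v) - F x - D (?y + v - x)) - (F ?y - F x - D (?y - x))"
        by (simp add: algebra_simps)
      also have "norm \<dots> \<le> \<epsilon> * norm (?y + v - x) + \<epsilon> * norm (?y - x)"
        by (intro order_trans[OF norm_triangle_ineq4] add_mono F inball y)
      also have "\<dots> \<le> \<epsilon> * (norm v + norm w) + \<epsilon> * (norm v + norm w)"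
        by (intro add_mono mult_left_mono inball y eps)
      finally show ?thesis by (simp add: norm_blinfun.rep_eq)
    qed
  qed auto
  moreover have "\<psi> (x + w) - \<psi> x = f (x + v + w) - f (x + v) - f (x + w) + f x - D v w"
    by (simp add: \<psi>_def blinfun.bilinear_simps algebra_simps)
  moreover have "norm w * (2 * \<epsilon> * (norm v + norm w)) \<le> 2 * \<epsilon> * (norm v + norm w)\<^sup>2"
    using mult_right_mono[of "norm w" "norm v + norm w" "2 * \<epsilon> * (norm v + norm w)"] eps
    by (simp add: power2_eq_square mult_ac)
  ultimately show ?thesis by simp
qed

text \<open>After shrinking \<open>v\<close> and \<open>w\<close> by a factor \<open>t\<close>, the second difference is \<open>t\<^sup>2 D v w\<close> and also \<open>t\<^sup>2 D w v\<close>, both up to \<open>o(t\<^sup>2)\<close>.\<close>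

lemma second_derivative_symmetric:
  fixes f :: "'a::real_normed_vector \<Rightarrow> 'b::real_normed_vector"
    and F :: "'a \<Rightarrow> 'a \<Rightarrow>\<^sub>L 'b"
  assumes "open S" "x \<in> S"
    and f: "\<And>y. y \<in> S \<Longrightarrow> (f has_derivative F y) (at y)"
    and F: "(F has_derivative D) (at x)"
  shows "D v w = D w v"
proof -
  define K where "K = norm v + norm w"
  have lin: "bounded_linear D" using F by (rule has_derivative_bounded_linear)
  have bound: "norm (D v w - D w v) \<le> 4 * K\<^sup>2 * \<epsilon>" if eps: "\<epsilon> > 0" for \<epsilon>
  proof -
    obtain d where d: "d > 0" "\<And>y. norm (y - x) < d \<Longrightarrow> norm (F y - F x - D (y - x)) \<le> \<epsilon> * norm (y - x)"
      using F eps unfolding has_derivative_at_alt by blast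
    obtain r' where r': "r' > 0" "ball x r' \<subseteq> S"
      using assms(1,2) open_contains_ball by blast
    define r where "r = min d r'"
    \<comment> \<open>The summand 1 keeps \<open>t\<close> positive when \<open>v = w = 0\<close>.\<close>
    define t where "t = r / (2 * (K + 1))"
    have K: "K \<ge> 0" by (simp add: K_def)
    have r: "r > 0" using d r' by (simp add: r_def)
    have t: "t > 0" using r K by (simp add: t_def)
    have "t * K < r"
      using r K by (simp add: t_def field_simps) (smt (verit) mult_nonneg_nonneg)
    then have small: "norm (t *\<^sub>R v) + norm (t *\<^sub>R w) < r" "norm (t *\<^sub>R w) + norm (t *\<^sub>R v) < r"
      using t by (simp_all add: K_def algebra_simps)
    have sq: "2 * \<epsilon> * (norm (t *\<^sub>R v) + norm (t *\<^sub>R w))\<^sup>2 = 2 * \<epsilon> * (t\<^sup>2 * K\<^sup>2)"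
      "2 * \<epsilon> * (norm (t *\<^sub>R w) + norm (t *\<^sub>R v))\<^sup>2 = 2 * \<epsilon> * (t\<^sup>2 * K\<^sup>2)"
      using t by (simp_all add: K_def power2_eq_square algebra_simps)
    have scale: "D (t *\<^sub>R v) (t *\<^sub>R w) = t\<^sup>2 *\<^sub>R D v w" for v w
      by (simp add: linear_scale[OF bounded_linear.linear[OF lin]] blinfun.bilinear_simps
          power2_eq_square)
    define \<Delta> where "\<Delta> = f (x + t *\<^sub>R v + t *\<^sub>R w) - f (x + t *\<^sub>R v) - f (x + t *\<^sub>R w) + f x"
    have \<Delta>_swap: "\<Delta> = f (x + t *\<^sub>R w + t *\<^sub>R v) - f (x + t *\<^sub>R w) - f (x + t *\<^sub>R v) + f x"
      by (simp add: \<Delta>_def add.assoc add.commute[of "t *\<^sub>R w"])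
    have f': "(f has_derivative F y) (at y)" if "y \<in> ball x r" for y
      using that r' by (intro f) (auto simp: r_def)
    have F': "norm (F y - F x - D (y - x)) \<le> \<epsilon> * norm (y - x)" if "y \<in> ball x r" for y
      using that by (intro d) (auto simp: r_def dist_norm norm_minus_commute)
    have "norm (\<Delta> - t\<^sup>2 *\<^sub>R D v w) \<le> 2 * \<epsilon> * (t\<^sup>2 * K\<^sup>2)"
      using second_difference_bound[OF f' lin F' small(1) less_imp_le[OF eps]]
      unfolding scale sq \<Delta>_def .
    moreover have "norm (\<Delta> - t\<^sup>2 *\<^sub>R D w v) \<le> 2 * \<epsilon> * (t\<^sup>2 * K\<^sup>2)"
      using second_difference_bound[OF f' lin F' small(2) less_imp_le[OF eps]]
      unfolding scale sq \<Delta>_swap .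
    moreover have "t\<^sup>2 *\<^sub>R (D v w - D w v) = (\<Delta> - t\<^sup>2 *\<^sub>R D w v) - (\<Delta> - t\<^sup>2 *\<^sub>R D v w)"
      by (simp add: algebra_simps)
    then have "t\<^sup>2 * norm (D v w - D w v) = norm ((\<Delta> - t\<^sup>2 *\<^sub>R D w v) - (\<Delta> - t\<^sup>2 *\<^sub>R D v w))"
      by (metis abs_power2 norm_scaleR)
    ultimately have "t\<^sup>2 * norm (D v w - D w v) \<le> t\<^sup>2 * (4 * K\<^sup>2 * \<epsilon>)"
      using norm_triangle_ineq4[of "\<Delta> - t\<^sup>2 *\<^sub>R D w v" "\<Delta> - t\<^sup>2 *\<^sub>R D v w"]
      by (simp add: algebra_simps)
    then show ?thesis using t by (subst (asm) mult_le_cancel_left_pos) auto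
  qed
  have "norm (D v w - D w v) \<le> 0"
  proof (rule field_le_epsilon)
    fix \<delta> :: real assume "\<delta> > 0"
    have pos: "4 * K\<^sup>2 + 1 > 0" by (simp add: add_nonneg_pos)
    have "4 * K\<^sup>2 * (\<delta> / (4 * K\<^sup>2 + 1)) \<le> \<delta>"
      using \<open>\<delta> > 0\<close> pos by (simp add: field_simps)
    moreover have "\<delta> / (4 * K\<^sup>2 + 1) > 0"
      using \<open>\<delta> > 0\<close> pos by simp
    ultimately show "norm (D v w - D w v) \<le> 0 + \<delta>"
      using bound by force
  qed
  then show ?thesis by simp
qed

section \<open>A quantitative first-order expansion\<close>

text \<open>The Cauchy inequality on discs of radius \<open>R/4\<close> bounds the second derivative by
  \<open>2 M / (R/4)\<^sup>2 = 32 M / R\<^sup>2\<close> on the disc of radius \<open>R/2\<close>, which contains the segment from 0 to 1.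
  The decay in \<open>R\<close> is what matters: it becomes a factor \<open>\<parallel>h\<parallel>\<^sup>2\<close> when \<open>\<phi>\<close> is a function
  restricted to the complex line in direction \<open>h\<close>.\<close>

lemma bounded_holomorphic_linear_remainder:
  assumes hol: "\<phi> holomorphic_on ball 0 R" and R: "2 \<le> R"
    and M: "\<And>z. z \<in> ball 0 R \<Longrightarrow> cmod (\<phi> z) \<le> M"
  shows "cmod (\<phi> 1 - \<phi> 0 - deriv \<phi> 0) \<le> 32 * M / R\<^sup>2"
proof -
  let ?S = "cball (0 :: complex) (R / 2)"
  have sub: "cball w (R / 4) \<subseteq> ball 0 R" if "w \<in> ?S" for w
  proof
    fix z assume "z \<in> cball w (R / 4)"
    then show "z \<in> ball 0 R"
      using that R dist_triangle[of 0 z w] by simp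
  qed
  have "cmod ((deriv ^^ 0) \<phi> 1 - (\<Sum>i\<le>1. (deriv ^^ i) \<phi> 0 * (1 - 0) ^ i / fact i))
      \<le> 32 * M / R\<^sup>2 * cmod (1 - 0) ^ Suc 1 / fact 1"
  proof (rule complex_Taylor[where S = ?S])
    show "((deriv ^^ i) \<phi> has_field_derivative (deriv ^^ Suc i) \<phi> z) (at z within ?S)"
      if "z \<in> ?S" for i z
    proof -
      have "(deriv ^^ i) \<phi> holomorphic_on ball 0 R"
        by (rule holomorphic_higher_deriv[OF hol open_ball])
      then have "((deriv ^^ i) \<phi> has_field_derivative deriv ((deriv ^^ i) \<phi>) z) (at z)"
        using that R by (intro holomorphic_derivI[OF _ open_ball]) auto
      then show ?thesis by (simp add: has_field_derivative_at_within)
    qed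
    show "cmod ((deriv ^^ Suc 1) \<phi> z) \<le> 32 * M / R\<^sup>2" if z: "z \<in> ?S" for z
    proof -
      have "cmod ((deriv ^^ Suc 1) \<phi> z) \<le> fact (Suc 1) * M / (R / 4) ^ Suc 1"
      proof (rule Cauchy_inequality)
        show "\<phi> holomorphic_on ball z (R / 4)"
          using sub[OF z] by (meson ball_subset_cball hol holomorphic_on_subset order_trans)
        show "continuous_on (cball z (R / 4)) \<phi>"
          using sub[OF z] hol by (meson holomorphic_on_imp_continuous_on holomorphic_on_subset)
        show "cmod (\<phi> w) \<le> M" if "cmod (z - w) = R / 4" for w
          using sub[OF z] that by (intro M) (auto simp: subset_iff dist_norm)
      qed (use R in simp)
      then show ?thesis by (simp add: power2_eq_square field_simps)
    qed
  qed (use R in auto)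
  then show ?thesis by (simp add: algebra_simps)
qed

section \<open>Maps into the dual\<close>

lemma bounded_linear_blinfun_of_cdual:
  "bounded_linear (blinfun_of_cdual :: 'a::complex_normed_vector cdual \<Rightarrow> _)"
  by (rule bounded_linear_intro[where K = 1]) (simp_all add: cdual_simps norm_cdual_def)

lemma bounded_bilinear_cdual_apply:
  "bounded_bilinear (cdual_apply :: 'a::complex_normed_vector cdual \<Rightarrow> _)"
  using bounded_bilinear.comp1[OF bounded_bilinear_blinfun_apply bounded_linear_blinfun_of_cdual] .

lemma norm_cdual_apply_le: "cmod (cdual_apply \<phi> x) \<le> norm \<phi> * norm x"
  by (simp add: norm_cdual_def norm_blinfun)

lemma bounded_linear_scaleC_left:
  "bounded_linear (\<lambda>z. z *\<^sub>C (x :: 'a::complex_normed_vector))"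
  by (rule bounded_linear_intro[where K = "norm x"])
    (simp_all add: scaleC_add_left scaleC_complex_def scaleC_scaleC scaleR_scaleC norm_scaleC)

text \<open>The form is separately continuous, so it can be applied termwise to a basis expansion in
  either variable. Expanding \<open>w\<close> gives symmetry for \<open>v = e\<^sub>k\<close>, and then expanding \<open>v\<close> gives it
  for all \<open>v\<close>.\<close>

lemma symmetric_if_symmetric_on_basis:
  fixes e :: "nat \<Rightarrow> 'a::complex_banach" and D :: "'a \<Rightarrow> 'a cdual"
  assumes e: "schauder_basis e"
    and lin: "bounded_linear D" and D: "\<And>c v. D (c *\<^sub>C v) = c *\<^sub>C D v"
    and sym: "\<And>k n. cdual_apply (D (e k)) (e n) = cdual_apply (D (e n)) (e k)"
  shows "cdual_apply (D v) w = cdual_apply (D w) v"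
proof -
  have left: "(\<lambda>n. coord e n v * cdual_apply (D (e n)) w) sums cdual_apply (D v) w" for v w
  proof -
    have "bounded_linear (\<lambda>v. cdual_apply (D v) w)"
      by (intro bounded_bilinear.bounded_linear_left[OF bounded_bilinear_cdual_apply]
          bounded_linear_compose[where g = D, OF _ lin])
    from bounded_linear.sums[OF this coord_sums[OF e]] show ?thesis
      by (simp add: D cdual_simps)
  qed
  have right: "(\<lambda>n. coord e n w * cdual_apply (D v) (e n)) sums cdual_apply (D v) w" for v w
    using bounded_linear.sums[OF blinfun.bounded_linear_right coord_sums[OF e],
        of "blinfun_of_cdual (D v)" w]
    by (simp add: cdual_apply_scaleC)
  have basis: "cdual_apply (D (e k)) w = cdual_apply (D w) (e k)" for k w
    using right[of w "e k"] left[of w "e k"] sums_unique2 by (simp add: sym[of k]) blast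
  show ?thesis
    using left[of v w] right[of v w] sums_unique2 by (simp add: basis) blast
qed

section \<open>The primitive of a symmetric map\<close>

text \<open>The integral is differentiated by a direct estimate: the linearization error of the integrand
  in \<open>x\<close> is quadratic in the increment, with a constant that does not depend on \<open>t\<close>, because
  \<open>g\<close> is bounded and its derivative is complex-linear.\<close>

lemma poincare_unit_ball:
  fixes g :: "'a::complex_banach \<Rightarrow> 'a cdual"
  assumes g: "\<And>x. x \<in> ball 0 1 \<Longrightarrow> (g has_derivative D x) (at x)"
    and D: "\<And>x c v. x \<in> ball 0 1 \<Longrightarrow> D x (c *\<^sub>C v) = c *\<^sub>C D x v"
    and sym: "\<And>x v w. x \<in> ball 0 1 \<Longrightarrow> cdual_apply (D x v) w = cdual_apply (D x w) v"
    and M: "\<And>x. x \<in> ball 0 1 \<Longrightarrow> norm (g x) \<le> M"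
    and x: "x \<in> ball 0 1"
  shows "((\<lambda>x. integral {0..1} (\<lambda>t. cdual_apply (g (t *\<^sub>R x)) x)) has_derivative
           cdual_apply (g x)) (at x)" (is "(?f has_derivative _) _")
proof -
  define r where "r = 1 - norm x"
  have r: "r > 0" using x by (simp add: r_def)
  have segment: "t *\<^sub>R y \<in> ball 0 1" if "y \<in> ball 0 1" "t \<in> {0..1}" for t and y :: 'a
  proof -
    have "t * norm y \<le> norm y" using that by (intro mult_left_le_one_le) auto
    then show ?thesis using that by simp
  qed
  have cont: "continuous_on {0..1} (\<lambda>t. cdual_apply (g (t *\<^sub>R y)) y)" if "y \<in> ball 0 1" for y
  proof -
    have "continuous_on (ball 0 1) g"
      by (meson g has_derivative_continuous continuous_at_imp_continuous_on)
    then have "continuous_on {0..1} (\<lambda>t. g (t *\<^sub>R y))"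
      by (rule continuous_on_compose2) (auto intro!: continuous_intros segment that simp del: mem_ball)
    then show ?thesis
      by (intro bounded_bilinear.continuous_on[OF bounded_bilinear_cdual_apply] continuous_intros)
  qed
  define \<phi> where "\<phi> h t z = cdual_apply (g (t *\<^sub>R (x + z *\<^sub>C h))) (x + z *\<^sub>C h)" for h t z
  define \<phi>' where "\<phi>' h t = complex_of_real t * cdual_apply (D (t *\<^sub>R x) h) x
      + cdual_apply (g (t *\<^sub>R x)) h" for h t
  have \<phi>_deriv: "(\<phi> h t has_field_derivative
        complex_of_real t * cdual_apply (D (t *\<^sub>R (x + z *\<^sub>C h)) h) (x + z *\<^sub>C h)
          + cdual_apply (g (t *\<^sub>R (x + z *\<^sub>C h))) h) (at z)"
    if t: "t \<in> {0..1}" and z: "x + z *\<^sub>C h \<in> ball 0 1" for h t z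
  proof -
    let ?u = "\<lambda>z. x + z *\<^sub>C h" and ?p = "t *\<^sub>R (x + z *\<^sub>C h)"
    have p: "?p \<in> ball 0 1" by (rule segment[OF z t])
    have u: "(?u has_derivative (\<lambda>\<zeta>. \<zeta> *\<^sub>C h)) (at z)"
      by (auto intro!: derivative_eq_intros
          bounded_linear_imp_has_derivative[OF bounded_linear_scaleC_left])
    have tu: "((\<lambda>z. t *\<^sub>R ?u z) has_derivative (\<lambda>\<zeta>. t *\<^sub>R (\<zeta> *\<^sub>C h))) (at z)"
      by (rule has_derivative_scaleR_right[OF u])
    have gu: "((\<lambda>z. g (t *\<^sub>R ?u z)) has_derivative (\<lambda>\<zeta>. D ?p (t *\<^sub>R (\<zeta> *\<^sub>C h)))) (at z)"
      by (rule has_derivative_compose[OF tu g[OF p]])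
    have "(\<phi> h t has_derivative (\<lambda>\<zeta>. cdual_apply (g ?p) (\<zeta> *\<^sub>C h)
        + cdual_apply (D ?p (t *\<^sub>R (\<zeta> *\<^sub>C h))) (?u z))) (at z)"
      unfolding \<phi>_def
      by (rule bounded_bilinear.FDERIV[OF bounded_bilinear_cdual_apply gu u])
    moreover have "D ?p (t *\<^sub>R (\<zeta> *\<^sub>C h)) = (complex_of_real t * \<zeta>) *\<^sub>C D ?p h" for \<zeta>
      by (simp add: scaleR_scaleC[of t "\<zeta> *\<^sub>C h"] scaleC_scaleC D[OF p])
    ultimately show ?thesis
      unfolding has_field_derivative_def
      by (elim has_derivative_eq_rhs) (simp add: fun_eq_iff cdual_simps cdual_apply_scaleC algebra_simps)
  qed
  \<comment> \<open>This is the step that uses the symmetry: it exchanges \<open>h\<close> and \<open>x\<close> in \<open>D (t x) h x\<close>, which makes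
    \<open>\<phi>' h\<close> a derivative in \<open>t\<close>. Every derivative is gauge integrable, with the
    value given by the fundamental theorem of calculus.\<close>
  have \<phi>'_integral: "(\<phi>' h has_integral cdual_apply (g x) h) {0..1}" for h
  proof -
    have "((\<lambda>t. t *\<^sub>R cdual_apply (g (t *\<^sub>R x)) h) has_vector_derivative \<phi>' h t)
        (at t within {0..1})" if t: "t \<in> {0..1}" for t
    proof -
      have p: "t *\<^sub>R x \<in> ball 0 1" by (rule segment[OF x t])
      have Dx: "D (t *\<^sub>R x) (s *\<^sub>R x) = s *\<^sub>R D (t *\<^sub>R x) x" for s
        by (rule linear_scale[OF has_derivative_linear[OF g[OF p]]])
      have "((\<lambda>t. g (t *\<^sub>R x)) has_derivative (\<lambda>s. D (t *\<^sub>R x) (s *\<^sub>R x))) (at t)"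
        by (rule has_derivative_compose[where f = "\<lambda>t. t *\<^sub>R x" and g = g, OF _ g[OF p]]) (auto intro!: derivative_eq_intros)
      then have "((\<lambda>t. cdual_apply (g (t *\<^sub>R x)) h) has_derivative
          (\<lambda>s. cdual_apply (D (t *\<^sub>R x) (s *\<^sub>R x)) h)) (at t)"
        by (rule bounded_linear.has_derivative[OF
              bounded_bilinear.bounded_linear_left[OF bounded_bilinear_cdual_apply]])
      from has_derivative_scaleR[OF has_derivative_ident this]
      have "((\<lambda>t. t *\<^sub>R cdual_apply (g (t *\<^sub>R x)) h) has_derivative (\<lambda>s. s *\<^sub>R \<phi>' h t)) (at t)"
        by (rule has_derivative_eq_rhs)
          (auto simp: fun_eq_iff \<phi>'_def sym[OF p, of x h] Dx cdual_simps
            blinfun.scaleR_left scaleR_conv_of_real algebra_simps)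
      then show ?thesis
        unfolding has_vector_derivative_def by (rule has_derivative_at_withinI)
    qed
    from fundamental_theorem_of_calculus[OF _ this] show ?thesis by simp
  qed
  have M0: "0 \<le> M" using M[of 0] norm_ge_zero[of "g 0"] by (simp del: norm_ge_zero)
  have remainder: "cmod (?f (x + h) - ?f x - cdual_apply (g x) h) \<le> 32 * M / r\<^sup>2 * (norm h)\<^sup>2"
    if h: "h \<noteq> 0" "norm h \<le> r / 2" for h
  proof -
    \<comment> \<open>For \<open>cmod z < R\<close> the point \<open>x + z h\<close> stays in the unit ball.\<close>
    define R where "R = r / norm h"
    have R: "R \<ge> 2" using h by (simp add: R_def field_simps)
    have inball: "x + z *\<^sub>C h \<in> ball 0 1" if "z \<in> ball 0 R" for z
    proof -
      have "norm (z *\<^sub>C h) < r"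
        using that h by (simp add: norm_scaleC R_def field_simps)
      then show ?thesis using norm_triangle_ineq[of x "z *\<^sub>C h"] by (simp add: r_def)
    qed
    have xh: "x + h \<in> ball 0 1" using inball[of 1] R by (simp add: scaleC_one)
    have pointwise: "cmod (\<phi> h t 1 - \<phi> h t 0 - \<phi>' h t) \<le> 32 * M / R\<^sup>2" if t: "t \<in> {0..1}" for t
    proof -
      have hol: "\<phi> h t holomorphic_on ball 0 R"
        unfolding holomorphic_on_open[OF open_ball] using \<phi>_deriv[OF t inball] by blast
      have "deriv (\<phi> h t) 0 = \<phi>' h t"
        using \<phi>_deriv[OF t, of 0 h] x
        by (intro DERIV_imp_deriv) (simp add: \<phi>'_def scaleC_zero_left)
      moreover have "cmod (\<phi> h t z) \<le> M" if z: "z \<in> ball 0 R" for z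
      proof -
        have "cmod (\<phi> h t z) \<le> norm (g (t *\<^sub>R (x + z *\<^sub>C h))) * norm (x + z *\<^sub>C h)"
          unfolding \<phi>_def by (rule norm_cdual_apply_le)
        also have "\<dots> \<le> M * 1"
          using inball[OF z] M0 by (intro mult_mono M segment t) auto
        finally show ?thesis by simp
      qed
      ultimately show ?thesis
        using bounded_holomorphic_linear_remainder[OF hol R, of M] by simp
    qed
    have int: "((\<lambda>t. cdual_apply (g (t *\<^sub>R y)) y) has_integral ?f y) {0..1}" if "y \<in> ball 0 1" for y
      using integrable_continuous_interval[OF cont[OF that]] by (rule integrable_integral)
    have "((\<lambda>t. \<phi> h t 1 - \<phi> h t 0 - \<phi>' h t) has_integral
        ?f (x + h) - ?f x - cdual_apply (g x) h) {0..1}"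
      using has_integral_diff[OF has_integral_diff[OF int[OF xh] int[OF x]] \<phi>'_integral[of h]]
      by (simp add: \<phi>_def scaleC_one scaleC_zero_left)
    then have "cmod (?f (x + h) - ?f x - cdual_apply (g x) h) \<le> 32 * M / R\<^sup>2 * measure lborel {0..1::real}"
      by (intro has_integral_bound_real[where f = "\<lambda>t. \<phi> h t 1 - \<phi> h t 0 - \<phi>' h t"] pointwise)
        (use M0 in auto)
    then show ?thesis using h by (simp add: R_def power_divide)
  qed
  show ?thesis
  proof (rule has_derivativeI_sandwich[where e = "r / 2" and H = "\<lambda>y. 32 * M / r\<^sup>2 * norm (y - x)"])
    show "norm (?f y - ?f x - cdual_apply (g x) (y - x)) / norm (y - x) \<le> 32 * M / r\<^sup>2 * norm (y - x)"
      if "y \<noteq> x" "dist y x < r / 2" for y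
      using remainder[of "y - x"] that
      by (simp add: dist_norm power2_eq_square pos_divide_le_eq mult.assoc)
    show "((\<lambda>y. 32 * M / r\<^sup>2 * norm (y - x)) \<longlongrightarrow> 0) (at x)"
      by (rule tendsto_eq_intros refl | simp)+
  qed (use r in \<open>auto intro: blinfun.bounded_linear_right\<close>)
qed

lemma in_HL0_if_differential_bounded:
  fixes f :: "'a::complex_banach \<Rightarrow> complex" and g :: "'a \<Rightarrow> 'a cdual"
  assumes f: "\<And>x. x \<in> ball 0 1 \<Longrightarrow> (f has_derivative cdual_apply (g x)) (at x)"
    and M: "\<And>x. x \<in> ball 0 1 \<Longrightarrow> norm (g x) \<le> M"
    and 0: "f 0 = 0"
  shows "f \<in> HL0"
proof -
  have M0: "0 \<le> M" using M[of 0] norm_ge_zero[of "g 0"] by (simp del: norm_ge_zero)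
  have diff: "norm (f x - f y) \<le> M * norm (x - y)" if "x \<in> ball 0 1" "y \<in> ball 0 1" for x y
    by (rule differentiable_bound[where f = f, OF convex_ball _ _ that])
      (use f M in \<open>auto simp: norm_cdual_def norm_blinfun.rep_eq intro: has_derivative_at_withinI\<close>)
  have "M-lipschitz_on (ball 0 1) f"
    using diff M0 by (intro lipschitz_onI) (auto simp: dist_norm)
  moreover have "bounded (f ` ball 0 1)"
  proof (rule boundedI)
    fix w assume "w \<in> f ` ball 0 1"
    then obtain x where x: "x \<in> ball 0 1" "w = f x" by blast
    have "norm (f x) \<le> M * norm x" using diff[OF x(1), of 0] 0 by simp
    also have "\<dots> \<le> M * 1" using x M0 by (intro mult_left_mono) auto
    finally show "norm w \<le> M" using x by simp
  qed
  moreover have "holomorphic_on_unit_ball f"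
    unfolding holomorphic_on_unit_ball_def
    using f by (fastforce simp: cdual_apply_scaleC scaleC_complex_def)
  ultimately show ?thesis using 0 by (auto simp: HL0_def H_infinity_def)
qed

section \<open>Characterization of differentials by their partial derivatives\<close>

theorem corollary3p7:
  fixes e :: "nat \<Rightarrow> 'a::complex_banach"
    and g :: "'a \<Rightarrow> 'a cdual"
    and gn :: "nat \<Rightarrow> 'a \<Rightarrow> complex"
  assumes "schauder_basis e"
    and "g \<in> H_infinity"
    and "coord_expansion e gn g"
  shows "(\<exists>f\<in>HL0. \<forall>x\<in>ball 0 1. cdual_apply (g x) = differential f x) \<longleftrightarrow>
    (\<forall>x\<in>ball 0 1. \<forall>k n. partial_derivative e k (gn n) x = partial_derivative e n (gn k) x)"
proof -
  obtain D where g: "\<And>x. x \<in> ball 0 1 \<Longrightarrow> (g has_derivative D x) (at x)"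
    and D: "\<And>x c v. x \<in> ball 0 1 \<Longrightarrow> D x (c *\<^sub>C v) = c *\<^sub>C D x v"
  proof -
    have "\<forall>x\<in>ball 0 1. \<exists>D. (g has_derivative D) (at x) \<and> (\<forall>c v. D (c *\<^sub>C v) = c *\<^sub>C D v)"
      using assms(2) unfolding H_infinity_def holomorphic_on_unit_ball_def by blast
    from bchoice[OF this] show ?thesis using that by blast
  qed
  obtain M where M: "\<And>x. x \<in> ball 0 1 \<Longrightarrow> norm (g x) \<le> M"
    using assms(2) unfolding H_infinity_def bounded_iff by blast
  have partial: "partial_derivative e k (gn n) x = cdual_apply (D x (e k)) (e n)"
    if x: "x \<in> ball 0 1" for x k n
  proof -
    have "((\<lambda>y. cdual_apply (g y) (e n)) has_derivative (\<lambda>v. cdual_apply (D x v) (e n))) (at x)"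
      by (rule bounded_linear.has_derivative[OF
            bounded_bilinear.bounded_linear_left[OF bounded_bilinear_cdual_apply] g[OF x]])
    then have "(gn n has_derivative (\<lambda>v. cdual_apply (D x v) (e n))) (at x)"
      by (rule has_derivative_transform_within_open[OF _ open_ball x])
        (use assms(3) coord_expansion_iff[OF assms(1)] in auto)
    then show ?thesis unfolding partial_derivative_def by (simp add: differential_eqI)
  qed
  show ?thesis
  proof
    assume "\<exists>f\<in>HL0. \<forall>x\<in>ball 0 1. cdual_apply (g x) = differential f x"
    then obtain f where f: "f \<in> HL0" "\<And>x. x \<in> ball 0 1 \<Longrightarrow> cdual_apply (g x) = differential f x"
      by blast
    have f': "(f has_derivative cdual_apply (g x)) (at x)" if x: "x \<in> ball 0 1" for x
    proof -
      have "holomorphic_on_unit_ball f" using f(1) by (simp add: HL0_def H_infinity_def)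
      then obtain L where L: "(f has_derivative L) (at x)"
        using x unfolding holomorphic_on_unit_ball_def by blast
      then show ?thesis using f(2)[OF x] differential_eqI[OF L] by simp
    qed
    have "cdual_apply (D x v) w = cdual_apply (D x w) v" if x: "x \<in> ball 0 1" for x v w
      by (rule second_derivative_symmetric[OF open_ball x f'
            bounded_linear.has_derivative[OF bounded_linear_blinfun_of_cdual g[OF x]]])
    then show "\<forall>x\<in>ball 0 1. \<forall>k n. partial_derivative e k (gn n) x = partial_derivative e n (gn k) x"
      by (simp add: partial)
  next
    assume *: "\<forall>x\<in>ball 0 1. \<forall>k n. partial_derivative e k (gn n) x = partial_derivative e n (gn k) x"
    define f where "f = (\<lambda>x. integral {0..1} (\<lambda>t. cdual_apply (g (t *\<^sub>R x)) x))"
    have sym: "cdual_apply (D x v) w = cdual_apply (D x w) v" if x: "x \<in> ball 0 1" for x v w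
    proof (rule symmetric_if_symmetric_on_basis[OF assms(1)])
      show "bounded_linear (D x)" by (rule has_derivative_bounded_linear[OF g[OF x]])
      show "D x (c *\<^sub>C v) = c *\<^sub>C D x v" for c v by (rule D[OF x])
      show "cdual_apply (D x (e k)) (e n) = cdual_apply (D x (e n)) (e k)" for k n
        using *[rule_format, OF x, of k n] unfolding partial[OF x] .
    qed
    have f': "(f has_derivative cdual_apply (g x)) (at x)" if "x \<in> ball 0 1" for x
      unfolding f_def by (rule poincare_unit_ball[OF g D sym M that])
    have "f \<in> HL0"
      by (rule in_HL0_if_differential_bounded[OF f' M]) (auto simp: f_def blinfun.zero_right)
    moreover have "\<forall>x\<in>ball 0 1. cdual_apply (g x) = differential f x"
      using differential_eqI[OF f'] by simp
    ultimately show "\<exists>f\<in>HL0. \<forall>x\<in>ball 0 1. cdual_apply (g x) = differential f x"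
      by blast
  qed
qed

end
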